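(* For every real $\theta<2$ and every $t>0$, $$E\Big[\exp\Big(\frac{\theta}{\int_0^t\exp(B_s)\,ds}\Big)\Big]<\infty.$$
   Context: $(B_t)_{t\ge 0}$ is a standard one-dimensional Brownian motion started at $0$. *)

theory Defs
  imports "HOL-Probability.Probability"
begin

text \<open>
  The time index is \<open>real\<close>, but only times \<open>\<ge> 0\<close> are constrained. The start at \<open>0\<close> and the
  continuity of paths are required almost surely, so the probability space need not be complete
  and exceptional paths are allowed. Note that \<^term>\<open>normal_density\<close> takes the standard deviation, not the
  variance, as its second argument.
\<close>

locale standard_brownian_motion = prob_space M
  for M :: "'a measure" +
  fixes B :: "real \<Rightarrow> 'a \<Rightarrow> real"
  assumes random_variable: "\<And>t. 0 \<le> t \<Longrightarrow> random_variable borel (B t)"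
    and start: "AE \<omega> in M. B 0 \<omega> = 0"
    and indep_increments:
      "\<And>(n :: nat) (u :: nat \<Rightarrow> real). 0 \<le> u 0 \<Longrightarrow> (\<And>i. i < n \<Longrightarrow> u i < u (Suc i)) \<Longrightarrow>
         indep_vars (\<lambda>_. borel) (\<lambda>i \<omega>. B (u (Suc i)) \<omega> - B (u i) \<omega>) {..<n}"
    and normal_increments:
      "\<And>s t. 0 \<le> s \<Longrightarrow> s < t \<Longrightarrow>
         distributed M lborel (\<lambda>\<omega>. B t \<omega> - B s \<omega>) (normal_density 0 (sqrt (t - s)))"
    and continuous_paths: "AE \<omega> in M. continuous_on {0..} (\<lambda>s. B s \<omega>)"

end

theory Submission
  imports Defs
begin

text \<open>
  Write \<open>A\<close> for the integral of \<open>exp B\<close> over \<open>[0, t]\<close>. The Hamilton--Jacobi equation for the cost of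
  keeping \<open>A\<close> below \<open>r\<close> has the solution \<open>2 exp b / c\<close>, where \<open>b\<close> is the current position and \<open>c\<close> is
  what is left of the budget \<open>r\<close>; hence \<open>exp (- 2 exp b / c)\<close>, extended by \<open>0\<close> to \<open>c \<le> 0\<close>, is a
  supermartingale along the path. It starts at \<open>exp (- 2 / r)\<close>. If \<open>A\<close> is less than \<open>x\<close> and \<open>r = (1 + e) x\<close>,
  then \<open>c\<close> stays above \<open>e x\<close>, so that by Jensen's inequality the time average of the supermartingale
  is at least \<open>exp (- 2 / (e t))\<close>. This gives \<open>P(A < x) \<le> exp (2 / (e t)) exp (- 2 / ((1 + e) x))\<close>
  for all \<open>e > 0\<close>, which is sharp enough for every \<open>\<theta> < 2\<close>.

  To avoid stochastic calculus, the integral is replaced by left Riemann sums with step \<open>h\<close>. One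
  Gaussian step increases the expectation of the potential by at most \<open>3 h\<^sup>2 / 16\<close>, so the total
  error vanishes as \<open>h\<close> tends to \<open>0\<close>.
\<close>

section \<open>Gaussian integrals for a single step\<close>

text \<open>
  Replacing \<open>exp x\<close> by the square \<open>(1 + x / 2)\<^sup>2\<close> makes the Gaussian integral of the potential explicit
  without losing the sharp constant; the fourth power pays for \<open>x < - 2\<close>, where the bound can fail.
\<close>

lemma exp_neg_mult_exp_le:
  fixes l x :: real
  assumes "0 \<le> l"
  shows "exp (- (l * exp x)) \<le> exp (- (l * (1 + x / 2)\<^sup>2)) + (x / 2) ^ 4"
proof (cases "- 2 \<le> x")
  case True
  have "(1 + x / 2)\<^sup>2 \<le> (exp (x / 2))\<^sup>2"
    using True by (intro power_mono exp_ge_add_one_self) auto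
  also have "\<dots> = exp x"
    by (simp add: power2_eq_square flip: exp_add)
  finally have "l * (1 + x / 2)\<^sup>2 \<le> l * exp x"
    using assms by (intro mult_left_mono)
  then show ?thesis
    by (smt (verit) exp_le_cancel_iff zero_le_even_power even_numeral)
next
  case False
  then have "1 ^ 4 \<le> (- (x / 2)) ^ 4"
    by (intro power_mono) auto
  then have "1 \<le> (x / 2) ^ 4"
    by simp
  moreover have "exp (- (l * exp x)) \<le> 1"
    using assms by simp
  ultimately show ?thesis
    by (smt (verit) exp_gt_zero)
qed

text \<open>Completing the square turns the integrand into a multiple of another Gaussian density,
  with mean \<open>m\<close> and variance \<open>h / d\<close> where
  \<open>d = 1 + h * l / 2\<close>. The exact value carries a further factor
  \<open>1 / sqrt d\<close>, which is at most 1 and is dropped.\<close>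

lemma nn_integral_normal_density_exp_square_le:
  fixes l h :: real
  assumes "0 < h" "0 \<le> l"
  shows "(\<integral>\<^sup>+x. ennreal (normal_density 0 (sqrt h) x) * ennreal (exp (- (l * (1 + x / 2)\<^sup>2))) \<partial>lborel)
           \<le> ennreal (exp (- (l / (1 + h * l / 2))))"
proof -
  define d where "d = 1 + h * l / 2"
  define s where "s = sqrt (h / d)"
  define m where "m = - l * (h / d)"
  have d: "1 \<le> d"
    using assms by (simp add: d_def)
  have s: "0 < s" "s\<^sup>2 = h / d" "s \<le> sqrt h"
  proof -
    have "0 < h / d" "h / d \<le> h / 1"
      using assms d by (simp, intro divide_left_mono) auto
    then show "0 < s" "s\<^sup>2 = h / d" "s \<le> sqrt h"
      by (simp_all add: s_def)
  qed
  have prefactor: "1 / sqrt (2 * pi * (sqrt h)\<^sup>2) \<le> 1 / sqrt (2 * pi * s\<^sup>2)"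
    using assms s(1) power_mono[OF s(3), of 2]
    by (intro divide_left_mono real_sqrt_le_mono mult_left_mono mult_pos_pos real_sqrt_gt_zero) auto
  have exponent: "- (x - 0)\<^sup>2 / (2 * (sqrt h)\<^sup>2) + - (l * (1 + x / 2)\<^sup>2) = - (x - m)\<^sup>2 / (2 * s\<^sup>2) + - (l / d)" for x
  proof -
    have l: "l = 2 * (d - 1) / h"
      using assms by (simp add: d_def)
    \<comment> \<open>With \<open>l\<close> expressed through \<open>d\<close>, one has
      \<open>u = d * (x - m)\<close>, so that completing the square becomes a polynomial identity in
      \<open>x\<close> and \<open>d\<close>.\<close>
    define u where "u = x * d + 2 * (d - 1)"
    have "x - m = u / d"
      using assms d by (simp add: m_def l u_def field_simps)
    then have sq: "(x - m)\<^sup>2 / (2 * s\<^sup>2) = u\<^sup>2 / (2 * h * d)"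
      using assms d by (simp add: s(2) power_divide) (simp add: power2_eq_square)
    have ld: "l / d = 4 * (d - 1) / (2 * h * d)"
      unfolding l divide_divide_eq_left using assms d by (subst frac_eq_eq) auto
    have "- (x - 0)\<^sup>2 / (2 * (sqrt h)\<^sup>2) - l * (1 + x / 2)\<^sup>2 = - (x\<^sup>2 * d + (d - 1) * d * (2 + x)\<^sup>2) / (2 * h * d)"
      using assms d by (simp add: l field_simps power2_eq_square)
    also have "x\<^sup>2 * d + (d - 1) * d * (2 + x)\<^sup>2 = u\<^sup>2 + 4 * (d - 1)"
      unfolding u_def by algebra
    also have "- (u\<^sup>2 + 4 * (d - 1)) / (2 * h * d) = - ((x - m)\<^sup>2 / (2 * s\<^sup>2)) - l / d"
      unfolding sq ld minus_divide_left diff_divide_distrib[symmetric] by (rule arg_cong2[where f = "(/)"]) simp_all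
    also have "\<dots> = - (x - m)\<^sup>2 / (2 * s\<^sup>2) - l / d"
      by simp
    finally show ?thesis
      by simp
  qed
  have "normal_density 0 (sqrt h) x * exp (- (l * (1 + x / 2)\<^sup>2)) \<le> exp (- (l / d)) * normal_density m s x" for x
  proof -
    have "normal_density 0 (sqrt h) x * exp (- (l * (1 + x / 2)\<^sup>2))
        = 1 / sqrt (2 * pi * (sqrt h)\<^sup>2) * exp (- (x - 0)\<^sup>2 / (2 * (sqrt h)\<^sup>2) + - (l * (1 + x / 2)\<^sup>2))"
      by (simp only: normal_density_def exp_add mult.assoc)
    also have "\<dots> \<le> 1 / sqrt (2 * pi * s\<^sup>2) * exp (- (x - m)\<^sup>2 / (2 * s\<^sup>2) + - (l / d))"
      unfolding exponent by (intro mult_right_mono prefactor) simp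
    also have "\<dots> = exp (- (l / d)) * normal_density m s x"
      by (simp only: normal_density_def exp_add mult.assoc mult.commute[of "exp (- (l / d))"])
    finally show ?thesis .
  qed
  then have "(\<integral>\<^sup>+x. ennreal (normal_density 0 (sqrt h) x) * ennreal (exp (- (l * (1 + x / 2)\<^sup>2))) \<partial>lborel)
      \<le> (\<integral>\<^sup>+x. ennreal (exp (- (l / d))) * ennreal (normal_density m s x) \<partial>lborel)"
    by (intro nn_integral_mono) (simp add: normal_density_nonneg ennreal_leI flip: ennreal_mult del: ennreal_le_iff)
  also have "\<dots> = ennreal (exp (- (l / d))) * (\<integral>\<^sup>+x. ennreal (normal_density m s x) \<partial>lborel)"
    by (intro nn_integral_cmult) auto
  also have "(\<integral>\<^sup>+x. ennreal (normal_density m s x) \<partial>lborel) = 1"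
    using s(1) by (subst nn_integral_eq_integral) (auto simp: normal_density_nonneg)
  finally show ?thesis
    by (simp add: d_def)
qed

lemma nn_integral_normal_density_fourth_moment:
  fixes h :: real
  assumes "0 < h"
  shows "(\<integral>\<^sup>+x. ennreal (normal_density 0 (sqrt h) x) * ennreal ((x / 2) ^ 4) \<partial>lborel) = ennreal (3 * h\<^sup>2 / 16)"
proof -
  have "has_bochner_integral lborel (\<lambda>x. normal_density 0 (sqrt h) x * (x - 0) ^ (2 * 2))
      (fact (2 * 2) / ((2 / (sqrt h)\<^sup>2) ^ 2 * fact 2))"
    using assms by (intro normal_moment_even) auto
  also have "fact (2 * 2) / ((2 / (sqrt h)\<^sup>2) ^ 2 * fact 2) = 3 * h\<^sup>2"
    using assms by (simp add: fact_numeral power2_eq_square field_simps)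
  finally have "has_bochner_integral lborel (\<lambda>x. normal_density 0 (sqrt h) x * x ^ 4 / 16) (3 * h\<^sup>2 / 16)"
    by (intro has_bochner_integral_divide_zero) simp
  then show ?thesis
    by (subst (asm) has_bochner_integral_iff, subst ennreal_mult[symmetric])
      (auto simp: normal_density_nonneg power_divide nn_integral_eq_integral)
qed

section \<open>The potential along a Gaussian random walk\<close>

text \<open>The value 0 is the limit as \<open>c\<close> decreases to 0. Budgets only shrink, so a
  path that has exhausted its budget stays at 0.\<close>

definition potential :: "real \<Rightarrow> real \<Rightarrow> real" where
  "potential b c = (if 0 < c then exp (- (2 * exp b / c)) else 0)"

lemma potential_nonneg [simp]: "0 \<le> potential b c"
  by (simp add: potential_def)

lemma measurable_potential [measurable]: "case_prod potential \<in> borel_measurable (borel \<Otimes>\<^sub>M borel)"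
  unfolding potential_def by measurable

text \<open>With \<open>q\<close> the budget left after paying \<open>h * exp b\<close>, the new
  potential is \<open>exp (- (l * exp x))\<close> for \<open>l = 2 * exp b / q\<close>. The
  quadratic bound replaces \<open>l\<close> by \<open>l / (1 + h * l / 2)\<close>, and since
  \<open>1 + h * l / 2 = c / q\<close> this is exactly \<open>2 * exp b / c\<close>: averaging over
  the step undoes the payment. Only the fourth moment remains as an error.\<close>

lemma nn_integral_potential_step_le:
  fixes b c h :: real
  assumes h: "0 < h"
  shows "(\<integral>\<^sup>+x. ennreal (normal_density 0 (sqrt h) x) * ennreal (potential (b + x) (c - h * exp b)) \<partial>lborel)
           \<le> ennreal (potential b c + 3 * h\<^sup>2 / 16)"
proof (cases "0 < c - h * exp b")
  case False
  then show ?thesis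
    by (simp add: potential_def)
next
  case True
  define q where "q = c - h * exp b"
  define l where "l = 2 * exp b / q"
  have q: "0 < q"
    using True by (simp add: q_def)
  have "0 < h * exp b"
    using h by simp
  then have c: "0 < c"
    using True by linarith
  have l: "0 \<le> l"
    using q by (simp add: l_def)
  have "1 + h * l / 2 = (q + h * exp b) / q"
    using q by (simp add: l_def add_divide_distrib)
  then have "1 + h * l / 2 = c / q"
    by (simp add: q_def)
  then have lc: "l / (1 + h * l / 2) = 2 * exp b / c"
    using q by (simp add: l_def)
  have "potential (b + x) (c - h * exp b) \<le> exp (- (l * (1 + x / 2)\<^sup>2)) + (x / 2) ^ 4" for x
    using exp_neg_mult_exp_le[OF l, of x] q by (simp add: potential_def l_def exp_add mult.assoc flip: q_def)
  then have "(\<integral>\<^sup>+x. ennreal (normal_density 0 (sqrt h) x) * ennreal (potential (b + x) (c - h * exp b)) \<partial>lborel)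
      \<le> (\<integral>\<^sup>+x. ennreal (normal_density 0 (sqrt h) x) * ennreal (exp (- (l * (1 + x / 2)\<^sup>2))) +
                ennreal (normal_density 0 (sqrt h) x) * ennreal ((x / 2) ^ 4) \<partial>lborel)"
    by (intro nn_integral_mono) (simp add: mult_left_mono flip: distrib_left ennreal_plus)
  also have "\<dots> = (\<integral>\<^sup>+x. ennreal (normal_density 0 (sqrt h) x) * ennreal (exp (- (l * (1 + x / 2)\<^sup>2))) \<partial>lborel) +
      (\<integral>\<^sup>+x. ennreal (normal_density 0 (sqrt h) x) * ennreal ((x / 2) ^ 4) \<partial>lborel)"
    by (intro nn_integral_add) auto
  also have "\<dots> \<le> ennreal (exp (- (l / (1 + h * l / 2)))) + ennreal (3 * h\<^sup>2 / 16)"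
    using nn_integral_normal_density_exp_square_le[OF h l] nn_integral_normal_density_fourth_moment[OF h]
    by (intro add_mono) auto
  also have "\<dots> = ennreal (potential b c + 3 * h\<^sup>2 / 16)"
    using c unfolding lc by (simp add: potential_def)
  finally show ?thesis .
qed

text \<open>The joint law of independent variables is a product, so Fubini applies. The inner
  integral stays over \<open>M\<close>, with \<open>X\<close> frozen, so that the density of
  \<open>Y\<close> can be inserted later.\<close>

lemma (in prob_space) nn_integral_indep_var:
  assumes "indep_var S X T Y" "f \<in> borel_measurable (S \<Otimes>\<^sub>M T)"
  shows "(\<integral>\<^sup>+\<omega>. f (X \<omega>, Y \<omega>) \<partial>M) = (\<integral>\<^sup>+\<omega>. (\<integral>\<^sup>+\<omega>'. f (X \<omega>, Y \<omega>') \<partial>M) \<partial>M)"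
proof -
  have X [measurable]: "X \<in> M \<rightarrow>\<^sub>M S" and Y [measurable]: "Y \<in> M \<rightarrow>\<^sub>M T"
    using assms(1) by (auto dest: indep_var_rv1 indep_var_rv2)
  note f [measurable] = assms(2)
  interpret Y: prob_space "distr M T Y"
    using Y by (rule prob_space_distr)
  have "(\<integral>\<^sup>+\<omega>. f (X \<omega>, Y \<omega>) \<partial>M) = (\<integral>\<^sup>+z. f z \<partial>distr M (S \<Otimes>\<^sub>M T) (\<lambda>\<omega>. (X \<omega>, Y \<omega>)))"
    by (subst nn_integral_distr) auto
  also have "distr M (S \<Otimes>\<^sub>M T) (\<lambda>\<omega>. (X \<omega>, Y \<omega>)) = distr M S X \<Otimes>\<^sub>M distr M T Y"
    using assms(1) by (simp add: indep_var_distribution_eq)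
  also have "(\<integral>\<^sup>+z. f z \<partial>(distr M S X \<Otimes>\<^sub>M distr M T Y)) = (\<integral>\<^sup>+x. (\<integral>\<^sup>+y. f (x, y) \<partial>distr M T Y) \<partial>distr M S X)"
    by (subst Y.nn_integral_fst) auto
  also have "\<dots> = (\<integral>\<^sup>+\<omega>. (\<integral>\<^sup>+y. f (X \<omega>, y) \<partial>distr M T Y) \<partial>M)"
    by (subst nn_integral_distr) auto
  also have "\<dots> = (\<integral>\<^sup>+\<omega>. (\<integral>\<^sup>+\<omega>'. f (X \<omega>, Y \<omega>') \<partial>M) \<partial>M)"
    using measurable_Pair2[OF f measurable_space[OF X]]
    by (intro nn_integral_cong nn_integral_distr Y) simp
  finally show ?thesis .
qed

text \<open>Induction on \<open>k\<close>: position and remaining budget depend on the first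
  \<open>k\<close> increments only, and the next increment is independent of them, so each step adds
  at most the one-step error.\<close>

lemma (in prob_space) nn_integral_potential_walk_le:
  fixes X :: "nat \<Rightarrow> 'a \<Rightarrow> real" and h r :: real
  assumes h: "0 < h" and r: "0 < r"
    and indep: "indep_vars (\<lambda>_. borel) X {..<n}"
    and normal: "\<And>i. i < n \<Longrightarrow> distributed M lborel (X i) (normal_density 0 (sqrt h))"
    and "k \<le> n"
  shows "(\<integral>\<^sup>+\<omega>. ennreal (potential (\<Sum>i<k. X i \<omega>) (r - h * (\<Sum>j<k. exp (\<Sum>i<j. X i \<omega>)))) \<partial>M)
           \<le> ennreal (exp (- (2 / r)) + real k * (3 * h\<^sup>2 / 16))"
  using \<open>k \<le> n\<close>
proof (induction k)
  case 0
  then show ?case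
    using r by (simp add: potential_def emeasure_space_1)
next
  case (Suc k)
  define S where "S x = (\<Sum>i<k. x i)" for x :: "nat \<Rightarrow> real"
  define C where "C x = r - h * (\<Sum>j<k. exp (\<Sum>i<j. x i))" for x :: "nat \<Rightarrow> real"
  \<comment> \<open>Past and next increment are packaged as random elements of product spaces, the
    form in which independence of disjoint blocks is available.\<close>
  define P where "P = (\<lambda>K. PiM K (\<lambda>_ :: nat. borel :: real measure))"
  define Z where "Z K \<omega> = restrict (\<lambda>i. X i \<omega>) K" for K \<omega>
  \<comment> \<open>The potential after the step, for past \<open>x\<close> and next increment
    \<open>y k\<close>. The payment uses the position before the step, as in a left Riemann
    sum.\<close>
  define f where "f = (\<lambda>(x, y). ennreal (potential (S x + y k) (C x - h * exp (S x))))"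
  have S [measurable]: "S \<in> borel_measurable (P {..<k})"
    unfolding S_def P_def by measurable
  have C [measurable]: "C \<in> borel_measurable (P {..<k})"
    unfolding C_def P_def by measurable
  have [measurable]: "(\<lambda>y. y k) \<in> borel_measurable (P {k})"
    unfolding P_def by measurable
  have f: "f \<in> borel_measurable (P {..<k} \<Otimes>\<^sub>M P {k})"
    unfolding f_def by measurable
  have indep_step: "indep_var (P {..<k}) (Z {..<k}) (P {k}) (Z {k})"
    unfolding Z_def P_def using Suc.prems by (intro indep_var_restrict[OF indep]) auto
  have Z [measurable]: "Z {..<k} \<in> M \<rightarrow>\<^sub>M P {..<k}"
    using indep_step by (rule indep_var_rv1)
  have SC_Z: "S (Z {..<k} \<omega>) = (\<Sum>i<k. X i \<omega>)" "C (Z {..<k} \<omega>) = r - h * (\<Sum>j<k. exp (\<Sum>i<j. X i \<omega>))" for \<omega>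
    by (simp_all add: S_def C_def Z_def)
  have step: "(\<integral>\<^sup>+\<omega>'. f (x, Z {k} \<omega>') \<partial>M) \<le> ennreal (potential (S x) (C x)) + ennreal (3 * h\<^sup>2 / 16)" for x
  proof -
    have "(\<integral>\<^sup>+\<omega>'. f (x, Z {k} \<omega>') \<partial>M) = (\<integral>\<^sup>+\<omega>'. ennreal (potential (S x + X k \<omega>') (C x - h * exp (S x))) \<partial>M)"
      by (simp add: f_def Z_def)
    also have "\<dots> = (\<integral>\<^sup>+y. ennreal (normal_density 0 (sqrt h) y) * ennreal (potential (S x + y) (C x - h * exp (S x))) \<partial>lborel)"
      using normal[of k] Suc.prems
      by (intro distributed_nn_integral[symmetric, where g = "\<lambda>y. ennreal (potential (S x + y) (C x - h * exp (S x)))"]) auto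
    also have "\<dots> \<le> ennreal (potential (S x) (C x)) + ennreal (3 * h\<^sup>2 / 16)"
      using nn_integral_potential_step_le[OF h] by (simp flip: ennreal_plus)
    finally show ?thesis .
  qed
  have "(\<integral>\<^sup>+\<omega>. ennreal (potential (\<Sum>i<Suc k. X i \<omega>) (r - h * (\<Sum>j<Suc k. exp (\<Sum>i<j. X i \<omega>)))) \<partial>M)
      = (\<integral>\<^sup>+\<omega>. f (Z {..<k} \<omega>, Z {k} \<omega>) \<partial>M)"
    by (intro nn_integral_cong) (simp add: f_def SC_Z, simp add: Z_def algebra_simps)
  also have "\<dots> = (\<integral>\<^sup>+\<omega>. (\<integral>\<^sup>+\<omega>'. f (Z {..<k} \<omega>, Z {k} \<omega>') \<partial>M) \<partial>M)"
    using indep_step f by (rule nn_integral_indep_var)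
  also have "\<dots> \<le> (\<integral>\<^sup>+\<omega>. ennreal (potential (S (Z {..<k} \<omega>)) (C (Z {..<k} \<omega>))) + ennreal (3 * h\<^sup>2 / 16) \<partial>M)"
    by (intro nn_integral_mono step)
  also have "\<dots> = (\<integral>\<^sup>+\<omega>. ennreal (potential (S (Z {..<k} \<omega>)) (C (Z {..<k} \<omega>))) \<partial>M) + ennreal (3 * h\<^sup>2 / 16)"
    by (subst nn_integral_add) (auto simp: emeasure_space_1)
  also have "\<dots> \<le> ennreal (exp (- (2 / r)) + real k * (3 * h\<^sup>2 / 16)) + ennreal (3 * h\<^sup>2 / 16)"
    using Suc by (intro add_right_mono) (simp add: SC_Z)
  also have "\<dots> = ennreal (exp (- (2 / r)) + real (Suc k) * (3 * h\<^sup>2 / 16))"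
    by (subst ennreal_plus[symmetric]) (simp_all add: distrib_right add_divide_distrib del: ennreal_plus)
  finally show ?case .
qed

section \<open>Lower tail of the exponential functional of the walk\<close>

text \<open>Jensen's inequality for a uniform average: \<open>exp\<close> lies above its tangent at
  \<open>m\<close>, and summing the tangents gives the bound.\<close>

lemma exp_mult_le_sum_exp:
  fixes y :: "nat \<Rightarrow> real"
  assumes "real n * m \<le> (\<Sum>k<n. y k)"
  shows "real n * exp m \<le> (\<Sum>k<n. exp (y k))"
proof -
  have "exp m * (1 + (y k - m)) \<le> exp (y k)" for k
    using mult_left_mono[OF exp_ge_add_one_self, of "exp m" "y k - m"]
    by (simp add: exp_diff add.commute)
  then have "(\<Sum>k<n. exp m * (1 + (y k - m))) \<le> (\<Sum>k<n. exp (y k))"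
    by (intro sum_mono)
  moreover have "(\<Sum>k<n. exp m * (1 + (y k - m))) = real n * exp m + exp m * ((\<Sum>k<n. y k) - real n * m)"
    by (simp add: sum_distrib_left sum.distrib sum_subtractf algebra_simps flip: sum_distrib_left)
  ultimately show ?thesis
    using assms by (smt (verit) mult_nonneg_nonneg exp_ge_zero)
qed

text \<open>Markov's inequality for the potential summed over all times \<open>k < n\<close>: its
  expectation is controlled by the supermartingale bound, and on the event it is at least
  \<open>real n * exp m\<close>.\<close>

lemma (in prob_space) emeasure_exponential_walk_less_le:
  fixes X :: "nat \<Rightarrow> 'a \<Rightarrow> real" and t e x :: real
  assumes t: "0 < t" and e: "0 < e" and x: "0 < x" and n: "0 < n"
    and indep: "indep_vars (\<lambda>_. borel) X {..<n}"
    and normal: "\<And>i. i < n \<Longrightarrow> distributed M lborel (X i) (normal_density 0 (sqrt (t / real n)))"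
  shows "emeasure M {\<omega> \<in> space M. t / real n * (\<Sum>j<n. exp (\<Sum>i<j. X i \<omega>)) < x}
           \<le> ennreal (exp (2 / (e * t)) * (exp (- (2 / ((1 + e) * x))) + 3 * t\<^sup>2 / (16 * real n)))"
proof -
  define h where "h = t / real n"
  define r where "r = (1 + e) * x"
  \<comment> \<open>On the event the budget stays above \<open>e * x\<close>, and the mean of
    \<open>2 * exp S / (e * x)\<close> over the positions \<open>S\<close> is at most
    \<open>2 / (e * t)\<close>, because \<open>real n * h = t\<close>.\<close>
  define m where "m = - (2 / (e * t))"
  define W where "W k \<omega> = potential (\<Sum>i<k. X i \<omega>) (r - h * (\<Sum>j<k. exp (\<Sum>i<j. X i \<omega>)))" for k \<omega>
  define E where "E = {\<omega> \<in> space M. h * (\<Sum>j<n. exp (\<Sum>i<j. X i \<omega>)) < x}"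
  have h: "0 < h" and r: "0 < r"
    using t n e x by (auto simp: h_def r_def)
  have X [measurable]: "X i \<in> borel_measurable M" if "i < n" for i
    using indep that by (auto simp: indep_vars_def)
  have S [measurable]: "(\<lambda>\<omega>. \<Sum>i<k. X i \<omega>) \<in> borel_measurable M" if "k \<le> n" for k
    using that by (intro borel_measurable_sum X) auto
  have expS [measurable]: "(\<lambda>\<omega>. \<Sum>j<k. exp (\<Sum>i<j. X i \<omega>)) \<in> borel_measurable M" if "k \<le> n" for k
    using that by (intro borel_measurable_sum borel_measurable_exp S measurable_compose[OF S borel_measurable_exp]) auto
  have W: "W k \<in> borel_measurable M" if "k \<le> n" for k
    using that unfolding W_def by measurable
  have E: "E \<in> sets M"
    unfolding E_def by measurable
  have W_nonneg: "0 \<le> W k \<omega>" for k \<omega>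
    by (simp add: W_def)
  have on_E: "real n * exp m \<le> (\<Sum>k<n. W k \<omega>)" if "\<omega> \<in> E" for \<omega>
  proof -
    have less: "h * (\<Sum>j<n. exp (\<Sum>i<j. X i \<omega>)) < x"
      using that by (simp add: E_def)
    have "real n * m \<le> (\<Sum>k<n. - (2 * exp (\<Sum>i<k. X i \<omega>) / (e * x)))"
    proof -
      have "(\<Sum>k<n. exp (\<Sum>i<k. X i \<omega>)) \<le> x / h"
        using less h by (simp add: field_simps)
      then have "2 / (e * x) * (\<Sum>k<n. exp (\<Sum>i<k. X i \<omega>)) \<le> 2 / (e * x) * (x / h)"
        using e x by (intro mult_left_mono) auto
      also have "\<dots> = - (real n * m)"
        using e x t n by (simp add: m_def h_def field_simps)
      finally show ?thesis
        by (simp add: sum_negf sum_distrib_left)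
    qed
    then have "real n * exp m \<le> (\<Sum>k<n. exp (- (2 * exp (\<Sum>i<k. X i \<omega>) / (e * x))))"
      by (rule exp_mult_le_sum_exp)
    also have "\<dots> \<le> (\<Sum>k<n. W k \<omega>)"
    proof (rule sum_mono)
      fix k assume "k \<in> {..<n}"
      then have "(\<Sum>j<k. exp (\<Sum>i<j. X i \<omega>)) \<le> (\<Sum>j<n. exp (\<Sum>i<j. X i \<omega>))"
        by (intro sum_mono2) auto
      then have "h * (\<Sum>j<k. exp (\<Sum>i<j. X i \<omega>)) \<le> x"
        using less h by (smt (verit) mult_left_mono)
      then have "e * x \<le> r - h * (\<Sum>j<k. exp (\<Sum>i<j. X i \<omega>))"
        by (simp add: r_def algebra_simps)
      moreover have "0 < e * x"
        using e x by simp
      ultimately show "exp (- (2 * exp (\<Sum>i<k. X i \<omega>) / (e * x))) \<le> W k \<omega>"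
        by (auto simp: W_def potential_def intro!: divide_left_mono)
    qed
    finally show ?thesis .
  qed
  have "ennreal (real n * exp m) * emeasure M E = (\<integral>\<^sup>+\<omega>. ennreal (real n * exp m) * indicator E \<omega> \<partial>M)"
    using E by (intro nn_integral_cmult_indicator[symmetric])
  also have "\<dots> \<le> (\<integral>\<^sup>+\<omega>. (\<Sum>k<n. ennreal (W k \<omega>)) \<partial>M)"
    using on_E W_nonneg by (intro nn_integral_mono) (auto simp: sum_ennreal intro!: ennreal_leI split: split_indicator)
  also have "\<dots> = (\<Sum>k<n. \<integral>\<^sup>+\<omega>. ennreal (W k \<omega>) \<partial>M)"
    using W by (intro nn_integral_sum) auto
  also have "\<dots> \<le> (\<Sum>k<n. ennreal (exp (- (2 / r)) + real n * (3 * h\<^sup>2 / 16)))"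
  proof (rule sum_mono)
    fix k assume k: "k \<in> {..<n}"
    have "(\<integral>\<^sup>+\<omega>. ennreal (W k \<omega>) \<partial>M) \<le> ennreal (exp (- (2 / r)) + real k * (3 * h\<^sup>2 / 16))"
      unfolding W_def using h r indep normal k
      by (intro nn_integral_potential_walk_le[where n = n]) (auto simp: h_def)
    also have "\<dots> \<le> ennreal (exp (- (2 / r)) + real n * (3 * h\<^sup>2 / 16))"
      using k by (intro ennreal_leI add_left_mono mult_right_mono) auto
    finally show "(\<integral>\<^sup>+\<omega>. ennreal (W k \<omega>) \<partial>M) \<le> ennreal (exp (- (2 / r)) + real n * (3 * h\<^sup>2 / 16))" .
  qed
  also have "\<dots> = ennreal (real n * (exp (- (2 / r)) + real n * (3 * h\<^sup>2 / 16)))"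
    by (simp add: ennreal_mult ennreal_of_nat_eq_real_of_nat)
  finally have "ennreal (real n * exp m * prob E) \<le> ennreal (real n * (exp (- (2 / r)) + real n * (3 * h\<^sup>2 / 16)))"
    by (simp add: emeasure_eq_measure ennreal_mult)
  then have "real n * (exp m * prob E) \<le> real n * (exp (- (2 / r)) + real n * (3 * h\<^sup>2 / 16))"
    by (subst (asm) ennreal_le_iff) (auto simp: mult.assoc)
  then have "exp m * prob E \<le> exp (- (2 / r)) + real n * (3 * h\<^sup>2 / 16)"
    using n by simp
  then have "prob E \<le> exp (- m) * (exp (- (2 / r)) + real n * (3 * h\<^sup>2 / 16))"
    by (simp add: exp_minus field_simps)
  also have "real n * (3 * h\<^sup>2 / 16) = 3 * t\<^sup>2 / (16 * real n)"
    using n by (simp add: h_def power2_eq_square)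
  finally show ?thesis
    by (simp add: emeasure_eq_measure E_def h_def m_def r_def)
qed

section \<open>Riemann sums, exponential moments from tails, and limits of events\<close>

text \<open>By the mean value theorem for the primitive \<open>F\<close>, the integral over each
  cell is \<open>h * f z\<close> for some \<open>z\<close> in the cell; uniform continuity compares
  \<open>f z\<close> with the value at the left endpoint.\<close>

lemma riemann_sum_tendsto_integral:
  fixes f :: "real \<Rightarrow> real" and t :: real
  assumes t: "0 < t" and f: "continuous_on {0..t} f"
  shows "(\<lambda>n. t / real n * (\<Sum>j<n. f (real j * (t / real n)))) \<longlonglongrightarrow> integral {0..t} f"
proof (rule LIMSEQ_I)
  fix e :: real assume e: "0 < e"
  define F where "F x = integral {0..x} f" for x
  have F: "(F has_real_derivative f x) (at x within {0..t})" if "x \<in> {0..t}" for x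
    unfolding F_def using integral_has_real_derivative[OF f that] .
  have "uniformly_continuous_on {0..t} f"
    using f by (intro compact_uniformly_continuous) auto
  then obtain d where d: "0 < d"
    and unif: "\<And>x y. x \<in> {0..t} \<Longrightarrow> y \<in> {0..t} \<Longrightarrow> dist y x < d \<Longrightarrow> dist (f y) (f x) < e / (2 * t)"
    unfolding uniformly_continuous_on_def using e t by (metis divide_pos_pos mult_pos_pos zero_less_numeral)
  obtain N where N: "t / d < real N"
    using reals_Archimedean2 by blast
  have "norm (t / real n * (\<Sum>j<n. f (real j * (t / real n))) - integral {0..t} f) < e" if "N < n" for n
  proof -
    define h where "h = t / real n"
    have n: "0 < n"
      using that by simp
    have "t / d < real n"
      using N that by linarith
    then have h: "0 < h" "h < d" "real n * h = t"
      using t d n by (auto simp: h_def field_simps)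
    have local: "\<bar>h * f (real j * h) - (F (real (Suc j) * h) - F (real j * h))\<bar> \<le> h * (e / (2 * t))" if "j < n" for j
    proof -
      have "real (Suc j) * h \<le> real n * h"
        using that h by (intro mult_right_mono) auto
      then have sub: "{real j * h..real (Suc j) * h} \<subseteq> {0..t}"
        using h by auto
      have lt: "real j * h < real (Suc j) * h"
        using h by simp
      have "\<exists>z\<in>{real j * h<..<real (Suc j) * h}. F (real (Suc j) * h) - F (real j * h) = (*) (f z) (real (Suc j) * h - real j * h)"
      proof (rule mvt_simple[OF lt])
        fix x assume "real j * h \<le> x" "x \<le> real (Suc j) * h"
        then show "(F has_derivative (*) (f x)) (at x within {real j * h..real (Suc j) * h})"
          using F[of x] sub by (auto simp: has_field_derivative_def intro: has_derivative_subset)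
      qed
      then obtain z where z: "real j * h < z" "z < real (Suc j) * h"
        and eq: "F (real (Suc j) * h) - F (real j * h) = h * f z"
        by (auto simp: algebra_simps)
      have "dist (f (real j * h)) (f z) < e / (2 * t)"
        using z subsetD[OF sub, of z] subsetD[OF sub, of "real j * h"] lt h
        by (intro unif) (auto simp: dist_real_def distrib_right)
      then have "\<bar>h * (f (real j * h) - f z)\<bar> \<le> h * (e / (2 * t))"
        using h unfolding abs_mult dist_real_def by (intro mult_mono) auto
      then show ?thesis
        unfolding eq by (simp add: right_diff_distrib)
    qed
    have "h * (\<Sum>j<n. f (real j * h)) - integral {0..t} f
        = (\<Sum>j<n. h * f (real j * h) - (F (real (Suc j) * h) - F (real j * h)))"
      using h sum_lessThan_telescope[of "\<lambda>j. F (real j * h)" n]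
      by (simp only: sum_subtractf sum_distrib_left[symmetric]) (simp add: F_def)
    also have "\<bar>\<dots>\<bar> \<le> (\<Sum>j<n. h * (e / (2 * t)))"
      by (rule order_trans[OF sum_abs]) (intro sum_mono local, simp)
    also have "\<dots> = e / 2"
      using t by (simp add: mult.assoc[symmetric] h(3))
    also have "\<dots> < e"
      using e by simp
    finally show ?thesis
      by (simp add: h_def)
  qed
  then show "\<exists>no. \<forall>n\<ge>no. norm (t / real n * (\<Sum>j<n. f (real j * (t / real n))) - integral {0..t} f) < e"
    by (intro exI[of _ "Suc N"]) auto
qed

text \<open>Slicing by the integer part of \<open>1 / L\<close> reduces the expectation to a
  geometric series with ratio \<open>exp (\<theta> - a) < 1\<close>.\<close>

lemma (in prob_space) nn_integral_exp_divide_finite: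
  fixes L :: "'a \<Rightarrow> real" and a C \<theta> :: real
  assumes [measurable]: "L \<in> borel_measurable M"
    and \<theta>: "0 \<le> \<theta>" "\<theta> < a" and C: "1 \<le> C"
    and tail: "\<And>x. 0 < x \<Longrightarrow> emeasure M {\<omega> \<in> space M. L \<omega> < x} \<le> ennreal (C * exp (- (a / x)))"
  shows "(\<integral>\<^sup>+\<omega>. ennreal (exp (\<theta> / L \<omega>)) \<partial>M) < \<infinity>"
proof -
  \<comment> \<open>Multiplying out avoids division by zero: \<open>D 0\<close> is the whole space,
    where the bound follows from \<open>1 \<le> C\<close>, and points with
    \<open>L \<omega> \<le> 0\<close> are included.\<close>
  define D where "D k = {\<omega> \<in> space M. real k * L \<omega> < 1}" for k :: nat
  have D [measurable]: "D k \<in> sets M" for k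
    unfolding D_def by measurable
  have emeasure_D: "emeasure M (D k) \<le> ennreal (C * exp (- (a * real k)))" for k
  proof (cases "k = 0")
    case True
    then show ?thesis
      using C by (simp add: D_def emeasure_space_1)
  next
    case False
    then have "D k = {\<omega> \<in> space M. L \<omega> < 1 / real k}"
      by (auto simp: D_def field_simps)
    then show ?thesis
      using tail[of "1 / real k"] False by simp
  qed
  have "ennreal (exp (\<theta> / L \<omega>)) \<le> (\<Sum>k. ennreal (exp (\<theta> * (real k + 1))) * indicator (D k) \<omega>)"
    if \<omega>: "\<omega> \<in> space M" for \<omega>
  proof -
    have "\<exists>k. \<omega> \<in> D k \<and> \<theta> / L \<omega> \<le> \<theta> * (real k + 1)"
    proof (cases "0 < L \<omega>")
      case True
      \<comment> \<open>The largest natural number strictly below \<open>1 / L \<omega>\<close>;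
        strictness puts \<open>\<omega>\<close> into \<open>D k\<close>.\<close>
      define k where "k = nat (\<lceil>1 / L \<omega>\<rceil> - 1)"
      have "0 < \<lceil>1 / L \<omega>\<rceil>"
        using True by simp
      then have "real k = of_int \<lceil>1 / L \<omega>\<rceil> - 1"
        by (simp add: k_def)
      then have k: "real k < 1 / L \<omega>" "1 / L \<omega> \<le> real k + 1"
        by linarith+
      have "\<omega> \<in> D k"
        using k(1) True \<omega> by (simp add: D_def field_simps)
      moreover have "\<theta> / L \<omega> \<le> \<theta> * (real k + 1)"
        using mult_left_mono[OF k(2) \<theta>(1)] by simp
      ultimately show ?thesis
        by blast
    next
      case False
      then have "\<theta> / L \<omega> \<le> 0"
        using \<theta> by (simp add: divide_nonneg_nonpos)
      then show ?thesis
        using \<omega> \<theta> by (intro exI[of _ 0]) (simp add: D_def)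
    qed
    then obtain k where "\<omega> \<in> D k" "\<theta> / L \<omega> \<le> \<theta> * (real k + 1)"
      by blast
    then have "ennreal (exp (\<theta> / L \<omega>)) \<le> ennreal (exp (\<theta> * (real k + 1))) * indicator (D k) \<omega>"
      by (simp add: ennreal_leI)
    also have "\<dots> \<le> (\<Sum>k. ennreal (exp (\<theta> * (real k + 1))) * indicator (D k) \<omega>)"
      using sum_le_suminf[of "\<lambda>k. ennreal (exp (\<theta> * (real k + 1))) * indicator (D k) \<omega>" "{k}"]
      by (simp only: sum.insert_if finite.emptyI sum.empty empty_iff if_False add_0_right) (simp add: summableI)
    finally show ?thesis .
  qed
  then have "(\<integral>\<^sup>+\<omega>. ennreal (exp (\<theta> / L \<omega>)) \<partial>M) \<le> (\<integral>\<^sup>+\<omega>. (\<Sum>k. ennreal (exp (\<theta> * (real k + 1))) * indicator (D k) \<omega>) \<partial>M)"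
    by (intro nn_integral_mono)
  also have "\<dots> = (\<Sum>k. \<integral>\<^sup>+\<omega>. ennreal (exp (\<theta> * (real k + 1))) * indicator (D k) \<omega> \<partial>M)"
    by (intro nn_integral_suminf) measurable
  also have "\<dots> = (\<Sum>k. ennreal (exp (\<theta> * (real k + 1))) * emeasure M (D k))"
    by (simp add: nn_integral_cmult_indicator)
  also have "\<dots> \<le> (\<Sum>k. ennreal (C * exp \<theta> * exp (\<theta> - a) ^ k))"
  proof (intro suminf_le summableI)
    fix k
    have "ennreal (exp (\<theta> * (real k + 1))) * emeasure M (D k)
        \<le> ennreal (exp (\<theta> * (real k + 1))) * ennreal (C * exp (- (a * real k)))"
      using emeasure_D by (intro mult_left_mono) auto
    also have "\<dots> = ennreal (C * exp \<theta> * exp (\<theta> - a) ^ k)"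
      using C by (simp add: algebra_simps flip: ennreal_mult exp_of_nat_mult exp_add)
    finally show "ennreal (exp (\<theta> * (real k + 1))) * emeasure M (D k) \<le> ennreal (C * exp \<theta> * exp (\<theta> - a) ^ k)" .
  qed
  also have "\<dots> < \<infinity>"
  proof -
    have "summable (\<lambda>k. C * exp \<theta> * exp (\<theta> - a) ^ k)"
      using \<theta> by (intro summable_mult summable_geometric) simp
    then show ?thesis
      using C by (subst suminf_ennreal2) auto
  qed
  finally show ?thesis .
qed

text \<open>Fatou's lemma for indicators: the condition is open, so a limit below \<open>x\<close>
  forces \<open>R n \<omega> < x\<close> for all large \<open>n\<close>.\<close>

lemma (in finite_measure) emeasure_less_le_liminf:
  fixes L :: "'a \<Rightarrow> real" and R :: "nat \<Rightarrow> 'a \<Rightarrow> real"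
  assumes [measurable]: "L \<in> borel_measurable M" "\<And>n. R n \<in> borel_measurable M"
    and lim: "AE \<omega> in M. (\<lambda>n. R n \<omega>) \<longlonglongrightarrow> L \<omega>"
  shows "emeasure M {\<omega> \<in> space M. L \<omega> < x} \<le> liminf (\<lambda>n. emeasure M {\<omega> \<in> space M. R n \<omega> < x})"
proof -
  have "emeasure M {\<omega> \<in> space M. L \<omega> < x} = (\<integral>\<^sup>+\<omega>. indicator {\<omega> \<in> space M. L \<omega> < x} \<omega> \<partial>M)"
    by simp
  also have "\<dots> \<le> (\<integral>\<^sup>+\<omega>. liminf (\<lambda>n. indicator {\<omega> \<in> space M. R n \<omega> < x} \<omega>) \<partial>M)"
  proof (rule nn_integral_mono_AE, rule AE_mp[OF lim], intro AE_I2 impI)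
    fix \<omega>
    assume conv: "(\<lambda>n. R n \<omega>) \<longlonglongrightarrow> L \<omega>"
    show "indicator {\<omega> \<in> space M. L \<omega> < x} \<omega> \<le> liminf (\<lambda>n. indicator {\<omega> \<in> space M. R n \<omega> < x} \<omega> :: ennreal)"
    proof (cases "\<omega> \<in> {\<omega> \<in> space M. L \<omega> < x}")
      case True
      then have "\<forall>\<^sub>F n in sequentially. R n \<omega> < x"
        using order_tendstoD(2)[OF conv] by auto
      then have "\<forall>\<^sub>F n in sequentially. (1 :: ennreal) \<le> indicator {\<omega> \<in> space M. R n \<omega> < x} \<omega>"
        using True by (auto elim: eventually_mono)
      then have "1 \<le> liminf (\<lambda>n. indicator {\<omega> \<in> space M. R n \<omega> < x} \<omega> :: ennreal)"
        by (rule Liminf_bounded)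
      then show ?thesis
        using True by simp
    qed simp
  qed
  also have "\<dots> \<le> liminf (\<lambda>n. \<integral>\<^sup>+\<omega>. indicator {\<omega> \<in> space M. R n \<omega> < x} \<omega> \<partial>M)"
    by (intro nn_integral_liminf) measurable
  also have "\<dots> = liminf (\<lambda>n. emeasure M {\<omega> \<in> space M. R n \<omega> < x})"
    by simp
  finally show ?thesis .
qed

section \<open>Transfer to Brownian motion\<close>

context standard_brownian_motion
begin

text \<open>Written with increments, so that the walk estimate applies verbatim; when
  \<open>B 0 \<omega> = 0\<close> the inner sum telescopes to \<open>B\<close> at the grid point and
  this is the left Riemann sum.\<close>

definition exp_sum :: "real \<Rightarrow> nat \<Rightarrow> 'a \<Rightarrow> real" where
  "exp_sum t n \<omega> = t / real n * (\<Sum>j<n. exp (\<Sum>i<j. B (real (Suc i) * (t / real n)) \<omega> - B (real i * (t / real n)) \<omega>))"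

lemma measurable_exp_sum:
  assumes "0 < t"
  shows "exp_sum t n \<in> borel_measurable M"
proof -
  have "B (real i * (t / real n)) \<in> borel_measurable M" for i
    using assms by (intro random_variable) auto
  then show ?thesis
    unfolding exp_sum_def[abs_def]
    by (intro borel_measurable_times borel_measurable_const borel_measurable_sum
        borel_measurable_diff measurable_compose[OF _ borel_measurable_exp])
qed

lemma exp_sum_tendsto:
  assumes t: "0 < t"
  shows "AE \<omega> in M. (\<lambda>n. exp_sum t n \<omega>) \<longlonglongrightarrow> (LBINT s:{0..t}. exp (B s \<omega>))"
  using start continuous_paths
proof eventually_elim
  case (elim \<omega>)
  have cont: "continuous_on {0..t} (\<lambda>s. exp (B s \<omega>))"
    using elim(2) by (intro continuous_intros) (rule continuous_on_subset, auto)
  have "exp_sum t n \<omega> = t / real n * (\<Sum>j<n. exp (B (real j * (t / real n)) \<omega>))" for n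
    using elim(1) sum_lessThan_telescope[of "\<lambda>i. B (real i * (t / real n)) \<omega>"]
    by (simp add: exp_sum_def)
  moreover have "(LBINT s:{0..t}. exp (B s \<omega>)) = integral {0..t} (\<lambda>s. exp (B s \<omega>))"
    using cont by (intro set_borel_integral_eq_integral borel_integrable_atLeastAtMost')
  ultimately show ?case
    using riemann_sum_tendsto_integral[OF t cont] by simp
qed

lemma emeasure_exp_sum_less_le:
  assumes t: "0 < t" and e: "0 < e" and x: "0 < x" and n: "0 < n"
  shows "emeasure M {\<omega> \<in> space M. exp_sum t n \<omega> < x}
           \<le> ennreal (exp (2 / (e * t)) * (exp (- (2 / ((1 + e) * x))) + 3 * t\<^sup>2 / (16 * real n)))"
proof -
  define u where "u i = real i * (t / real n)" for i
  have u: "0 \<le> u i" "u i < u (Suc i)" "u (Suc i) - u i = t / real n" for i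
    using t n by (auto simp: u_def field_simps)
  have "indep_vars (\<lambda>_. borel) (\<lambda>i \<omega>. B (u (Suc i)) \<omega> - B (u i) \<omega>) {..<n}"
    by (intro indep_increments u)
  moreover have "distributed M lborel (\<lambda>\<omega>. B (u (Suc i)) \<omega> - B (u i) \<omega>) (normal_density 0 (sqrt (t / real n)))" for i
    using normal_increments[OF u(1,2), of i] unfolding u(3) .
  ultimately show ?thesis
    using emeasure_exponential_walk_less_le[OF t e x n] unfolding exp_sum_def u_def by blast
qed

text \<open>For fixed \<open>e\<close> and \<open>x\<close> the discretization error is of order
  \<open>1 / n\<close> and disappears in the limit. The limit \<open>L\<close> is arbitrary because
  the pathwise integral itself need not be measurable.\<close>

lemma exp_integral_tail:
  assumes t: "0 < t" and e: "0 < e"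
    and [measurable]: "L \<in> borel_measurable M" and L: "AE \<omega> in M. (\<lambda>n. exp_sum t n \<omega>) \<longlonglongrightarrow> L \<omega>"
    and x: "0 < x"
  shows "emeasure M {\<omega> \<in> space M. L \<omega> < x} \<le> ennreal (exp (2 / (e * t)) * exp (- (2 / ((1 + e) * x))))"
proof -
  define b where "b n = exp (2 / (e * t)) * (exp (- (2 / ((1 + e) * x))) + 3 * t\<^sup>2 / (16 * real n))" for n :: nat
  have "(\<lambda>n. 3 * t\<^sup>2 / 16 / real n) \<longlonglongrightarrow> 0"
    by (rule lim_const_over_n)
  then have "b \<longlonglongrightarrow> exp (2 / (e * t)) * (exp (- (2 / ((1 + e) * x))) + 0)"
    unfolding b_def by (intro tendsto_intros) simp
  then have b: "(\<lambda>n. ennreal (b n)) \<longlonglongrightarrow> ennreal (exp (2 / (e * t)) * exp (- (2 / ((1 + e) * x))))"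
    by (intro tendsto_ennrealI) simp
  have "emeasure M {\<omega> \<in> space M. L \<omega> < x} \<le> liminf (\<lambda>n. emeasure M {\<omega> \<in> space M. exp_sum t n \<omega> < x})"
    using measurable_exp_sum[OF t] L by (intro emeasure_less_le_liminf) auto
  also have "\<dots> \<le> liminf (\<lambda>n. ennreal (b n))"
    using emeasure_exp_sum_less_le[OF t e x]
    by (intro Liminf_mono) (auto simp: b_def intro!: eventually_sequentiallyI[of 1])
  also have "\<dots> = ennreal (exp (2 / (e * t)) * exp (- (2 / ((1 + e) * x))))"
    using b by (intro lim_imp_Liminf) auto
  finally show ?thesis .
qed

end

section \<open>Finiteness of the exponential moment\<close>

theorem corollary6p3:
  fixes M :: "'a measure" and B :: "real \<Rightarrow> 'a \<Rightarrow> real" and \<theta> t :: real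
  assumes "standard_brownian_motion M B"
    and "\<theta> < 2" and "0 < t"
  shows "(\<integral>\<^sup>+ \<omega>. ennreal (exp (\<theta> / (LBINT s:{0..t}. exp (B s \<omega>)))) \<partial>M) < \<infinity>"
proof -
  interpret standard_brownian_motion M B
    by fact
  define A where "A \<omega> = (LBINT s:{0..t}. exp (B s \<omega>))" for \<omega>
  \<comment> \<open>\<open>A\<close> need not be measurable, but it agrees almost surely with \<open>L\<close>, which is.\<close>
  define L where "L \<omega> = lim (\<lambda>n. exp_sum t n \<omega>)" for \<omega>
  \<comment> \<open>The moment criterion requires a nonnegative exponent; raising
    \<open>\<theta>\<close> to 0 only enlarges the integrand, as \<open>A\<close> is
    nonnegative.\<close>
  define \<theta>' where "\<theta>' = max \<theta> 0"
  \<comment> \<open>Chosen so that \<open>2 / (1 + e) = (2 + \<theta>') / 2\<close>, the midpoint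
    between \<open>\<theta>'\<close> and 2.\<close>
  define e where "e = (2 - \<theta>') / (2 + \<theta>')"
  have \<theta>': "0 \<le> \<theta>'" "\<theta> \<le> \<theta>'" "\<theta>' < 2"
    using assms by (auto simp: \<theta>'_def)
  then have e: "0 < e" "\<theta>' < 2 / (1 + e)"
    by (auto simp: e_def field_simps)
  have lim: "AE \<omega> in M. (\<lambda>n. exp_sum t n \<omega>) \<longlonglongrightarrow> A \<omega>"
    unfolding A_def using assms by (intro exp_sum_tendsto)
  then have L_eq: "AE \<omega> in M. L \<omega> = A \<omega>"
    by eventually_elim (simp add: L_def limI)
  have L_meas: "L \<in> borel_measurable M"
    unfolding L_def[abs_def] using measurable_exp_sum[OF assms(3)] by measurable
  have L_lim: "AE \<omega> in M. (\<lambda>n. exp_sum t n \<omega>) \<longlonglongrightarrow> L \<omega>"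
    using lim L_eq by eventually_elim simp
  \<comment> \<open>This holds on exceptional paths too, since the integral is 0 by default when the
    integrand is not integrable.\<close>
  have A_nonneg: "0 \<le> A \<omega>" for \<omega>
    unfolding A_def set_lebesgue_integral_def by (intro integral_nonneg_AE) auto
  have "(\<integral>\<^sup>+\<omega>. ennreal (exp (\<theta> / A \<omega>)) \<partial>M) \<le> (\<integral>\<^sup>+\<omega>. ennreal (exp (\<theta>' / L \<omega>)) \<partial>M)"
    using L_eq \<theta>' A_nonneg by (intro nn_integral_mono_AE) (auto intro!: ennreal_leI divide_right_mono elim!: eventually_mono)
  also have "\<dots> < \<infinity>"
  proof (rule nn_integral_exp_divide_finite[OF L_meas \<theta>'(1) e(2)])
    show "1 \<le> exp (2 / (e * t))"
      using e assms by simp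
    show "emeasure M {\<omega> \<in> space M. L \<omega> < x} \<le> ennreal (exp (2 / (e * t)) * exp (- (2 / (1 + e) / x)))" if "0 < x" for x
      using exp_integral_tail[OF assms(3) e(1) L_meas L_lim that] by simp
  qed
  finally show ?thesis
    unfolding A_def .
qed

end
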